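(* Let $p$ be a prime and $n\ge 1$ an integer. Let $M$ be the set of all tuples $(m_0,m_1,\ldots,m_n)$ of nonnegative integers with $\sum_{j=0}^{n} m_j=p$ and $\sum_{j=0}^{n} j\,m_j=n$. Assume that $m_i<p$ for all $i\in\{0,\ldots,n\}$ and all $(m_0,\ldots,m_n)\in M$ (or that $\gcd(n,p)=1$). Let $N$ be the number of $n$-variable balanced symmetric functions over $GF(p)$. Then $$N\ \ge\ \prod_{(m_0,\ldots,m_n)\in M}\ \frac{\left(\frac{p!}{m_0!\,m_1!\cdots m_n!}\right)!}{\left(\left(\frac{(p-1)!}{m_0!\,m_1!\cdots m_n!}\right)!\right)^p}.$$
   Context: A function $f: GF(p)^n\to GF(p)$ is symmetric if $f(x_{\pi(1)},\ldots,x_{\pi(n)})=f(x_1,\ldots,x_n)$ for every permutation $\pi$ of $\{1,\ldots,n\}$ and all $x$. It is balanced if $\#\{x\in GF(p)^n : f(x)=k\}=p^{n-1}$ for every $k\in GF(p)$. *)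

theory Defs
  imports Complex_Main "HOL-Library.FuncSet" "HOL-Combinatorics.Permutations"
    "HOL-Number_Theory.Residues"
begin

text \<open>For prime \<open>p\<close>, \<open>GF p\<close> is the field of integers modulo \<open>p\<close>, with carrier \<open>{0..int p - 1}\<close>.\<close>

abbreviation GF :: "nat \<Rightarrow> int ring"
  where "GF p \<equiv> residue_ring (int p)"

text \<open>Vectors and functions are extensional, so that distinct objects of these sets are
  distinct mathematically and \<^const>\<open>card\<close> counts them correctly.\<close>

definition GF_vectors :: "nat \<Rightarrow> nat \<Rightarrow> (nat \<Rightarrow> int) set"
  where "GF_vectors p n = {1..n} \<rightarrow>\<^sub>E carrier (GF p)"

definition GF_functions :: "nat \<Rightarrow> nat \<Rightarrow> ((nat \<Rightarrow> int) \<Rightarrow> int) set"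
  where "GF_functions p n = GF_vectors p n \<rightarrow>\<^sub>E carrier (GF p)"

definition symmetric_function :: "nat \<Rightarrow> nat \<Rightarrow> ((nat \<Rightarrow> int) \<Rightarrow> int) \<Rightarrow> bool"
  where "symmetric_function p n f \<longleftrightarrow>
    (\<forall>\<pi>. \<pi> permutes {1..n} \<longrightarrow>
      (\<forall>x\<in>GF_vectors p n. f (\<lambda>i\<in>{1..n}. x (\<pi> i)) = f x))"

definition balanced_function :: "nat \<Rightarrow> nat \<Rightarrow> ((nat \<Rightarrow> int) \<Rightarrow> int) \<Rightarrow> bool"
  where "balanced_function p n f \<longleftrightarrow>
    (\<forall>k\<in>carrier (GF p). card {x \<in> GF_vectors p n. f x = k} = p ^ (n - 1))"

definition num_balanced_symmetric :: "nat \<Rightarrow> nat \<Rightarrow> nat"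
  where "num_balanced_symmetric p n =
    card {f \<in> GF_functions p n. balanced_function p n f \<and> symmetric_function p n f}"

definition M_tuples :: "nat \<Rightarrow> nat \<Rightarrow> (nat \<Rightarrow> nat) set"
  where "M_tuples p n =
    {m \<in> {0..n} \<rightarrow>\<^sub>E UNIV. (\<Sum>j=0..n. m j) = p \<and> (\<Sum>j=0..n. j * m j) = n}"

text \<open>The next lemmas show that the two natural-number divisions \<^term>\<open>fact p div (\<Prod>j=0..n. fact (m j))\<close>
  and \<^term>\<open>fact (p - 1) div (\<Prod>j=0..n. fact (m j))\<close> are exact
  when \<^term>\<open>m \<in> M_tuples p n\<close> and the hypotheses of the theorem hold.\<close>

lemma prod_fact_dvd_fact_sum:
  fixes m :: "'a \<Rightarrow> nat"
  assumes "finite A"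
  shows "(\<Prod>j\<in>A. fact (m j)) dvd (fact (\<Sum>j\<in>A. m j) :: nat)"
  using assms
proof (induction rule: finite_induct)
  case (insert a A)
  have "fact (m a) * (\<Prod>j\<in>A. fact (m j)) dvd fact (m a) * (fact (\<Sum>j\<in>A. m j) :: nat)"
    using insert.IH by (rule mult_dvd_mono[OF dvd_refl])
  also have "\<dots> dvd fact (m a + (\<Sum>j\<in>A. m j))"
    by (rule fact_fact_dvd_fact)
  finally show ?case using insert.hyps by simp
qed simp

lemma M_tuples_dvd_fact:
  assumes "m \<in> M_tuples p n"
  shows "(\<Prod>j=0..n. fact (m j)) dvd (fact p :: nat)"
  using prod_fact_dvd_fact_sum[of "{0..n}" m] assms by (simp add: M_tuples_def)

lemma M_tuples_less_if_coprime:
  assumes p: "prime p" and cop: "coprime n p" and m: "m \<in> M_tuples p n" and i: "i \<le> n"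
  shows "m i < p"
proof (rule ccontr)
  assume "\<not> m i < p"
  have s: "(\<Sum>j=0..n. m j) = p" and t: "(\<Sum>j=0..n. j * m j) = n"
    using m by (auto simp: M_tuples_def)
  have split: "(\<Sum>j=0..n. m j) = m i + (\<Sum>j\<in>{0..n}-{i}. m j)"
    using i by (intro sum.remove) auto
  have eq: "m i = p" and z: "(\<Sum>j\<in>{0..n}-{i}. m j) = 0"
    using split s \<open>\<not> m i < p\<close> by linarith+
  have "n = (\<Sum>j=0..n. j * m j)" by (simp add: t)
  also have "\<dots> = i * m i + (\<Sum>j\<in>{0..n}-{i}. j * m j)"
    using i by (intro sum.remove) auto
  also have "(\<Sum>j\<in>{0..n}-{i}. j * m j) = 0"
    using z by simp
  finally have "p dvd n" using eq by simp
  then show False using p cop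
    by (metis coprime_common_divisor dvd_refl not_prime_unit)
qed

lemma M_tuples_dvd_fact_pred:
  assumes p: "prime p"
    and hyp: "(\<forall>m\<in>M_tuples p n. \<forall>i\<in>{0..n}. m i < p) \<or> gcd n p = 1"
    and m: "m \<in> M_tuples p n"
  shows "(\<Prod>j=0..n. fact (m j)) dvd (fact (p - 1) :: nat)"
proof -
  have "m i < p" if "i \<in> {0..n}" for i
    using hyp m that M_tuples_less_if_coprime[OF p] by (auto simp: coprime_iff_gcd_eq_1)
  then have "coprime (\<Prod>j=0..n. fact (m j) :: nat) p"
    using p by (intro prod_coprime_left) 
      (metis coprime_commute linorder_not_less prime_dvd_fact_iff prime_imp_coprime)
  moreover have "(\<Prod>j=0..n. fact (m j)) dvd p * (fact (p - 1) :: nat)"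
    using M_tuples_dvd_fact[OF m] prime_gt_0_nat[OF p] by (simp add: fact_reduce)
  ultimately show ?thesis by (simp add: coprime_dvd_mult_right_iff)
qed

end

(*
  A symmetric function f depends only on the counts c of a vector x, where c k is the number of
  coordinates of x equal to k. The counts in turn have a type m, where m j is the number of k
  with c k = j; the types that occur are exactly the members of M. The number of vectors with counts c
  is n! / (\<Prod>k. (c k)!), which depends only on the type of c, and p! / (\<Prod>j. (m j)!) counts have
  type m. This number is divisible by p under the hypothesis, so distributing the counts of each type
  evenly among the p values yields balanced functions, as many as the right-hand side says. All three
  numbers are instances of the multinomial count of functions with prescribed fibre sizes.
*)

theory Submission
  imports Defs
begin

section \<open>Functions with prescribed fibre sizes\<close>

text \<open>Used with three meanings: vectors with given counts (\<open>S = {1..n}\<close>,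
  \<open>K\<close> the field), counts of a given type (\<open>S\<close> the field,
  \<open>K = {0..n}\<close>), and distributions of the counts of one type among the field
  values.\<close>

definition fibre_funs :: "'a set \<Rightarrow> 'b set \<Rightarrow> ('b \<Rightarrow> nat) \<Rightarrow> ('a \<Rightarrow> 'b) set"
  where "fibre_funs S K d = {h \<in> S \<rightarrow>\<^sub>E K. \<forall>k\<in>K. card {x\<in>S. h x = k} = d k}"

lemma finite_fibre_funs: "finite S \<Longrightarrow> finite K \<Longrightarrow> finite (fibre_funs S K d)"
  unfolding fibre_funs_def by (simp add: finite_PiE)

text \<open>Choosing the fibre over \<open>k\<close> first leaves a function on the rest of
  \<open>S\<close> with values in \<open>K\<close>; this is the recursion behind the multinomial
  count.\<close>

lemma bij_betw_fibre_funs_insert: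
  assumes "k \<notin> K"
  shows "bij_betw (\<lambda>h. ({x\<in>S. h x = k}, restrict h (S - {x\<in>S. h x = k})))
    (fibre_funs S (insert k K) d)
    (SIGMA B:{B. B \<subseteq> S \<and> card B = d k}. fibre_funs (S - B) K d)"
\<comment> \<open>The inverse glues the constant \<open>k\<close> on \<open>B\<close> to
  \<open>h\<close> off \<open>B\<close>.\<close>
proof (rule bij_betw_byWitness[where f' = "\<lambda>(B, h). \<lambda>x\<in>S. if x \<in> B then k else h x"])
  show "\<forall>h\<in>fibre_funs S (insert k K) d.
      (\<lambda>(B, h). \<lambda>x\<in>S. if x \<in> B then k else h x)
        ({x\<in>S. h x = k}, restrict h (S - {x\<in>S. h x = k})) = h"
    unfolding fibre_funs_def by (auto simp: fun_eq_iff PiE_def extensional_def)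
  show "\<forall>q\<in>SIGMA B:{B. B \<subseteq> S \<and> card B = d k}. fibre_funs (S - B) K d.
      (\<lambda>h. ({x\<in>S. h x = k}, restrict h (S - {x\<in>S. h x = k})))
        ((\<lambda>(B, h). \<lambda>x\<in>S. if x \<in> B then k else h x) q) = q"
  proof
    fix q assume q: "q \<in> (SIGMA B:{B. B \<subseteq> S \<and> card B = d k}. fibre_funs (S - B) K d)"
    obtain B h where [simp]: "q = (B, h)" by (cases q)
    have B: "B \<subseteq> S" and h: "h \<in> (S - B) \<rightarrow>\<^sub>E K" using q by (auto simp: fibre_funs_def)
    \<comment> \<open>Off \<open>B\<close> the values of \<open>h\<close> lie in \<open>K\<close>
      and so differ from \<open>k\<close>.\<close>
    have eq: "{x\<in>S. (\<lambda>x\<in>S. if x \<in> B then k else h x) x = k} = B"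
      using B h assms by (auto split: if_splits)
    show "(\<lambda>h. ({x\<in>S. h x = k}, restrict h (S - {x\<in>S. h x = k})))
        ((\<lambda>(B, h). \<lambda>x\<in>S. if x \<in> B then k else h x) q) = q"
      using eq h by (auto simp: fun_eq_iff PiE_def extensional_def)
  qed
  show "(\<lambda>h. ({x\<in>S. h x = k}, restrict h (S - {x\<in>S. h x = k}))) ` fibre_funs S (insert k K) d
      \<subseteq> (SIGMA B:{B. B \<subseteq> S \<and> card B = d k}. fibre_funs (S - B) K d)"
  proof (rule image_subsetI)
    fix h assume h: "h \<in> fibre_funs S (insert k K) d"
    have "{x \<in> S - {x\<in>S. h x = k}. restrict h (S - {x\<in>S. h x = k}) x = l} = {x\<in>S. h x = l}"
      if "l \<in> K" for l
      using that assms by auto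
    then show "({x\<in>S. h x = k}, restrict h (S - {x\<in>S. h x = k}))
        \<in> (SIGMA B:{B. B \<subseteq> S \<and> card B = d k}. fibre_funs (S - B) K d)"
      using h by (auto simp: fibre_funs_def)
  qed
  show "(\<lambda>(B, h). \<lambda>x\<in>S. if x \<in> B then k else h x)
      ` (SIGMA B:{B. B \<subseteq> S \<and> card B = d k}. fibre_funs (S - B) K d)
      \<subseteq> fibre_funs S (insert k K) d"
  proof clarify
    fix B h assume B: "B \<subseteq> S" "card B = d k" and h: "h \<in> fibre_funs (S - B) K d"
    have "{x\<in>S. (\<lambda>x\<in>S. if x \<in> B then k else h x) x = k} = B"
      using B h assms by (auto simp: fibre_funs_def split: if_splits)
    moreover have "{x\<in>S. (\<lambda>x\<in>S. if x \<in> B then k else h x) x = l} = {x\<in>S-B. h x = l}"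
      if "l \<in> K" for l
      using that assms by auto
    ultimately show "(\<lambda>x\<in>S. if x \<in> B then k else h x) \<in> fibre_funs S (insert k K) d"
      using B h by (fastforce simp: fibre_funs_def)
  qed
qed

text \<open>Induction on \<open>K\<close> with \<open>S\<close> varying: a binomial coefficient
  counts the fibres over the new value, and its factorials telescope. The product form keeps
  division of naturals out of the induction.\<close>

theorem card_fibre_funs:
  assumes "finite K" "finite S" "(\<Sum>k\<in>K. d k) = card S"
  shows "card (fibre_funs S K d) * (\<Prod>k\<in>K. fact (d k)) = fact (card S)"
  using assms
proof (induction K arbitrary: S rule: finite_induct)
  case empty
  then show ?case by (simp add: fibre_funs_def)
next
  case (insert k K)
  have le: "d k \<le> card S" using insert by simp
  let ?P = "\<Prod>k\<in>K. fact (d k) :: nat"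
  let ?BB = "{B. B \<subseteq> S \<and> card B = d k}"
  have fin: "finite ?BB" using insert.prems by simp
  have "card (fibre_funs S (insert k K) d) = card (SIGMA B:?BB. fibre_funs (S - B) K d)"
    by (rule bij_betw_same_card[OF bij_betw_fibre_funs_insert]) (use insert in auto)
  also have "\<dots> = (\<Sum>B\<in>?BB. card (fibre_funs (S - B) K d))"
    using fin insert by (subst card_SigmaI) (auto intro: finite_fibre_funs)
  finally have "card (fibre_funs S (insert k K) d) * ?P
      = (\<Sum>B\<in>?BB. card (fibre_funs (S - B) K d) * ?P)"
    by (simp add: sum_distrib_right)
  also have "\<dots> = (\<Sum>B\<in>?BB. fact (card S - d k))"
  proof (rule sum.cong[OF refl])
    fix B assume B: "B \<in> ?BB"
    then have "card (S - B) = card S - d k"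
      using insert.prems by (auto simp: card_Diff_subset finite_subset)
    then show "card (fibre_funs (S - B) K d) * ?P = fact (card S - d k)"
      using insert.IH[of "S - B"] insert.prems insert.hyps by simp
  qed
  also have "\<dots> = (card S choose d k) * fact (card S - d k)"
    using insert.prems by (simp add: n_subsets)
  finally have "card (fibre_funs S (insert k K) d) * ?P * fact (d k)
      = fact (d k) * fact (card S - d k) * (card S choose d k)"
    by (simp add: mult_ac)
  then show ?case
    using insert.hyps binomial_fact_lemma[OF le] by (simp add: mult_ac)
qed

lemma card_fibre_funs_div:
  assumes "finite K" "finite S" "(\<Sum>k\<in>K. d k) = card S"
  shows "card (fibre_funs S K d) = fact (card S) div (\<Prod>k\<in>K. fact (d k))"
  using assms(1) by (simp add: card_fibre_funs[OF assms, symmetric] prod_zero_iff)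

section \<open>Counts and types\<close>

text \<open>Restriction to \<open>K\<close> makes the result extensional, so the construction can be
  iterated: applied to a vector it gives counts, applied to counts it gives their type.\<close>

definition fibre_sizes :: "'a set \<Rightarrow> 'b set \<Rightarrow> ('a \<Rightarrow> 'b) \<Rightarrow> 'b \<Rightarrow> nat"
  where "fibre_sizes S K h = (\<lambda>k\<in>K. card {x\<in>S. h x = k})"

lemma fibre_sizes_eq_iff:
  assumes "h \<in> S \<rightarrow>\<^sub>E K" "d \<in> extensional K"
  shows "fibre_sizes S K h = d \<longleftrightarrow> h \<in> fibre_funs S K d"
  using assms by (auto simp: fibre_sizes_def fibre_funs_def fun_eq_iff extensional_def)

text \<open>\<open>\<pi>\<close> maps each fibre of the permuted function bijectively onto the fibre
  of \<open>x\<close> over the same value.\<close>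

lemma fibre_sizes_permutes:
  assumes "\<pi> permutes S"
  shows "fibre_sizes S K (\<lambda>i\<in>S. x (\<pi> i)) = fibre_sizes S K x"
proof -
  have "card {i\<in>S. (\<lambda>i\<in>S. x (\<pi> i)) i = k} = card {i\<in>S. x i = k}" for k
  proof (rule bij_betw_same_card)
    have "\<pi> ` {i\<in>S. (\<lambda>i\<in>S. x (\<pi> i)) i = k} = {i\<in>S. x i = k}"
    proof (intro equalityI subsetI)
      fix i assume "i \<in> {i\<in>S. x i = k}"
      then show "i \<in> \<pi> ` {i\<in>S. (\<lambda>i\<in>S. x (\<pi> i)) i = k}"
        using assms permutes_inverses(1)[OF assms, of i]
          permutes_in_image[OF permutes_inv[OF assms], of i]
        by (intro image_eqI[where x = "inv_into UNIV \<pi> i"]) auto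
    qed (use permutes_in_image[OF assms] in auto)
    then show "bij_betw \<pi> {i\<in>S. (\<lambda>i\<in>S. x (\<pi> i)) i = k} {i\<in>S. x i = k}"
      using permutes_inj[OF assms] by (auto simp: bij_betw_def intro: inj_on_subset)
  qed
  then show ?thesis by (auto simp: fibre_sizes_def)
qed

lemma sum_fibre_sizes:
  assumes "finite S" "finite K" "h \<in> S \<rightarrow> K"
  shows "(\<Sum>k\<in>K. fibre_sizes S K h k) = card S"
  using sum.group[OF assms(1,2), of h "\<lambda>_. 1::nat"] assms(3)
    by (auto simp: fibre_sizes_def)

text \<open>On each fibre of \<open>h\<close> the summand is constant. With \<open>w\<close> the
  identity, this turns a sum of counts into the weighted sum in the definition of
  \<open>M_tuples\<close>.\<close>

lemma fibre_funs_sum: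
  fixes w :: "'b \<Rightarrow> nat"
  assumes "finite S" "finite K" "h \<in> fibre_funs S K d"
  shows "(\<Sum>x\<in>S. w (h x)) = (\<Sum>k\<in>K. w k * d k)"
proof -
  have "(\<Sum>x\<in>S. w (h x)) = (\<Sum>k\<in>K. \<Sum>x | x \<in> S \<and> h x = k. w (h x))"
    using assms by (subst sum.group) (auto simp: fibre_funs_def)
  also have "\<dots> = (\<Sum>k\<in>K. w k * d k)"
    using assms by (intro sum.cong) (auto simp: fibre_funs_def)
  finally show ?thesis .
qed

text \<open>With \<open>w = fact\<close>, this shows that the product of the factorials of the
  counts depends only on their type.\<close>

lemma fibre_funs_prod:
  fixes w :: "'b \<Rightarrow> nat"
  assumes "finite S" "finite K" "h \<in> fibre_funs S K d"
  shows "(\<Prod>x\<in>S. w (h x)) = (\<Prod>k\<in>K. w k ^ d k)"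
proof -
  have "(\<Prod>x\<in>S. w (h x)) = (\<Prod>k\<in>K. \<Prod>x | x \<in> S \<and> h x = k. w (h x))"
    using assms by (subst prod.group) (auto simp: fibre_funs_def)
  also have "\<dots> = (\<Prod>k\<in>K. w k ^ d k)"
    using assms by (intro prod.cong) (auto simp: fibre_funs_def)
  finally show ?thesis .
qed

lemma finite_M_tuples: "finite (M_tuples p n)"
proof (rule finite_subset)
  show "M_tuples p n \<subseteq> {0..n} \<rightarrow>\<^sub>E {0..p}"
  proof
    fix m assume m: "m \<in> M_tuples p n"
    have "m j \<le> p" if "j \<in> {0..n}" for j
      using m member_le_sum[OF that, of m] by (simp add: M_tuples_def)
    then show "m \<in> {0..n} \<rightarrow>\<^sub>E {0..p}"
      using m by (auto simp: M_tuples_def PiE_iff)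
  qed
qed (simp add: finite_PiE)

section \<open>Balanced symmetric functions from evenly distributed counts\<close>

context
  fixes p n :: nat and K :: "int set"
  assumes K_def: "K = carrier (GF p)" and p: "p > 0" and n: "n \<ge> 1"
begin

lemma finite_K: "finite K" and card_K: "card K = p"
  using p by (auto simp: K_def residue_ring_def)

lemma finite_vectors: "finite (GF_vectors p n)" and card_vectors: "card (GF_vectors p n) = p ^ n"
  using finite_K card_K by (auto simp: GF_vectors_def K_def[symmetric] finite_PiE card_PiE)

section \<open>Counts of vectors and types of counts\<close>

abbreviation counts :: "(nat \<Rightarrow> int) \<Rightarrow> int \<Rightarrow> nat"
  where "counts \<equiv> fibre_sizes {1..n} K"

abbreviation count_type :: "(int \<Rightarrow> nat) \<Rightarrow> nat \<Rightarrow> nat"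
  where "count_type \<equiv> fibre_sizes K {0..n}"

abbreviation counts_of_type :: "(nat \<Rightarrow> nat) \<Rightarrow> (int \<Rightarrow> nat) set"
  where "counts_of_type \<equiv> fibre_funs K {0..n}"

lemma counts_mem: "counts x \<in> K \<rightarrow>\<^sub>E {0..n}"
proof -
  have "card {i\<in>{1..n}. x i = k} \<le> n" for k
    by (rule order.trans[OF card_mono[of "{1..n}"]]) auto
  then show ?thesis by (auto simp: fibre_sizes_def)
qed

lemma counts_in_type: "counts x \<in> counts_of_type (count_type (counts x))"
  using fibre_sizes_eq_iff[OF counts_mem, of "count_type (counts x)" x]
  by (simp add: fibre_sizes_def)

text \<open>The first equation counts the \<open>p\<close> field values by how often they occur; the
  second counts the \<open>n\<close> coordinates by their value.\<close>

lemma count_type_mem_M: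
  assumes "x \<in> GF_vectors p n"
  shows "count_type (counts x) \<in> M_tuples p n"
proof -
  have "(\<Sum>j=0..n. count_type (counts x) j) = p"
    using sum_fibre_sizes[OF finite_K, of "{0..n}" "counts x"] counts_mem[of x] card_K by auto
  moreover have "(\<Sum>k\<in>K. counts x k) = n"
    using sum_fibre_sizes[of "{1..n}" K x] finite_K assms by (auto simp: GF_vectors_def K_def)
  then have "(\<Sum>j=0..n. j * count_type (counts x) j) = n"
    using fibre_funs_sum[OF finite_K _ counts_in_type, of "\<lambda>j. j" x] by simp
  ultimately show ?thesis by (simp add: M_tuples_def fibre_sizes_def)
qed

lemma card_counts_of_type:
  assumes "m \<in> M_tuples p n"
  shows "card (counts_of_type m) = fact p div (\<Prod>j=0..n. fact (m j))"
  using card_fibre_funs_div[OF _ finite_K, of "{0..n}" m] assms card_K by (simp add: M_tuples_def)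

text \<open>Membership fixes the sizes on \<open>{0..n}\<close>, and \<open>m\<close> is extensional
  there. Hence distinct types have disjoint sets of counts.\<close>

lemma count_type_eq:
  assumes "m \<in> M_tuples p n" "c \<in> counts_of_type m"
  shows "count_type c = m"
  using assms by (subst fibre_sizes_eq_iff) (auto simp: fibre_funs_def M_tuples_def PiE_iff)

lemma vectors_with_counts:
  assumes "c \<in> counts_of_type m"
  shows "{x \<in> GF_vectors p n. counts x = c} = fibre_funs {1..n} K c"
proof -
  have "c \<in> extensional K" using assms by (auto simp: fibre_funs_def PiE_iff)
  moreover have "fibre_funs {1..n} K c \<subseteq> {1..n} \<rightarrow>\<^sub>E K"
    unfolding fibre_funs_def by (rule Collect_restrict)
  ultimately show ?thesis
    unfolding GF_vectors_def K_def[symmetric] using fibre_sizes_eq_iff by blast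
qed

lemma card_vectors_with_counts:
  assumes m: "m \<in> M_tuples p n" and c: "c \<in> counts_of_type m"
  shows "card {x \<in> GF_vectors p n. counts x = c} * (\<Prod>j=0..n. fact j ^ m j) = fact n"
proof -
  have "(\<Sum>k\<in>K. c k) = n"
    using fibre_funs_sum[OF finite_K _ c, of "\<lambda>j. j"] m by (simp add: M_tuples_def)
  then show ?thesis
    using card_fibre_funs[OF finite_K, of "{1..n}" c] fibre_funs_prod[OF finite_K _ c, of fact]
    by (simp add: vectors_with_counts[OF c] del: One_nat_def)
qed

text \<open>The multinomial coefficient of any counts of type \<open>m\<close>, with equal
  factorials in the denominator collected.\<close>

definition type_weight :: "(nat \<Rightarrow> nat) \<Rightarrow> nat"
  where "type_weight m = fact n div (\<Prod>j=0..n. fact j ^ m j)"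

lemma card_vectors_with_counts_eq:
  assumes "m \<in> M_tuples p n" "c \<in> counts_of_type m"
  shows "card {x \<in> GF_vectors p n. counts x = c} = type_weight m"
  by (simp add: type_weight_def card_vectors_with_counts[OF assms, symmetric])

text \<open>The number of such vectors is a factor of \<open>fact n\<close>, hence nonzero. This
  makes every value of an assignment visible in the assembled function.\<close>

lemma vector_with_counts_exists:
  assumes "m \<in> M_tuples p n" "c \<in> counts_of_type m"
  obtains x where "x \<in> GF_vectors p n" "counts x = c"
proof -
  have "card {x \<in> GF_vectors p n. counts x = c} \<noteq> 0"
    using card_vectors_with_counts[OF assms] by (metis fact_nonzero mult_zero_left)
  then have "{x \<in> GF_vectors p n. counts x = c} \<noteq> {}" by (metis card.empty)
  then show thesis using that by blast
qed

section \<open>Balanced symmetric functions assembled from even assignments\<close>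

definition assemble :: "((nat \<Rightarrow> nat) \<Rightarrow> (int \<Rightarrow> nat) \<Rightarrow> int) \<Rightarrow> (nat \<Rightarrow> int) \<Rightarrow> int"
  where "assemble G = (\<lambda>x\<in>GF_vectors p n. G (count_type (counts x)) (counts x))"

text \<open>For each type \<open>m\<close> separately, \<open>G m\<close> gives every field value to
  exactly \<open>D m\<close> of the counts of that type.\<close>

abbreviation even_assignments ::
    "((nat \<Rightarrow> nat) \<Rightarrow> nat) \<Rightarrow> ((nat \<Rightarrow> nat) \<Rightarrow> (int \<Rightarrow> nat) \<Rightarrow> int) set"
  where "even_assignments D \<equiv> \<Pi>\<^sub>E m\<in>M_tuples p n. fibre_funs (counts_of_type m) K (\<lambda>_. D m)"

lemma inj_on_assemble: "inj_on assemble (even_assignments D)"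
proof (rule inj_onI)
  fix G H assume G: "G \<in> even_assignments D" and H: "H \<in> even_assignments D"
    and eq: "assemble G = assemble H"
  show "G = H"
  proof (rule PiE_ext[OF G H])
    fix m assume m: "m \<in> M_tuples p n"
    have "G m \<in> counts_of_type m \<rightarrow>\<^sub>E K" "H m \<in> counts_of_type m \<rightarrow>\<^sub>E K"
      using m PiE_mem[OF G m] PiE_mem[OF H m] by (auto simp: fibre_funs_def)
    then show "G m = H m"
    proof (rule PiE_ext)
      fix c assume c: "c \<in> counts_of_type m"
      obtain x where "x \<in> GF_vectors p n" "counts x = c"
        using vector_with_counts_exists[OF m c] .
      then show "G m c = H m c"
        using fun_cong[OF eq, of x] count_type_eq[OF m c] by (simp add: assemble_def)
    qed
  qed
qed

lemma assemble_mem_functions: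
  assumes "G \<in> even_assignments D"
  shows "assemble G \<in> GF_functions p n"
proof -
  have "G (count_type (counts x)) (counts x) \<in> K" if "x \<in> GF_vectors p n" for x
    using PiE_mem[OF assms count_type_mem_M[OF that]] counts_in_type[of x]
    by (auto simp: fibre_funs_def)
  then show ?thesis by (auto simp: assemble_def GF_functions_def K_def[symmetric])
qed

lemma symmetric_assemble: "symmetric_function p n (assemble G)"
proof -
  have "(\<lambda>i\<in>{1..n}. x (\<pi> i)) \<in> GF_vectors p n"
    if "\<pi> permutes {1..n}" "x \<in> GF_vectors p n" for \<pi> x
    using that permutes_in_image[OF that(1)] by (auto simp: GF_vectors_def)
  then show ?thesis
    by (auto simp: symmetric_function_def assemble_def fibre_sizes_permutes)
qed

text \<open>For each type, \<open>D m\<close> counts receive the value \<open>k\<close>, and each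
  comes from \<open>type_weight m\<close> vectors. The point is that the total does not involve
  \<open>k\<close>.\<close>

lemma card_assemble_fibre:
  assumes G: "G \<in> even_assignments D" and k: "k \<in> K"
  shows "card {x \<in> GF_vectors p n. assemble G x = k} = (\<Sum>m\<in>M_tuples p n. D m * type_weight m)"
proof -
  let ?C = "\<lambda>m. {c \<in> counts_of_type m. G m c = k}"
  have eq: "{x \<in> GF_vectors p n. assemble G x = k}
      = (\<Union>(m, c) \<in> (SIGMA m:M_tuples p n. ?C m). {x \<in> GF_vectors p n. counts x = c})"
  proof (intro equalityI subsetI)
    fix x assume x: "x \<in> {x \<in> GF_vectors p n. assemble G x = k}"
    then have "(count_type (counts x), counts x) \<in> (SIGMA m:M_tuples p n. ?C m)"
      using count_type_mem_M counts_in_type by (auto simp: assemble_def)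
    then show "x \<in> (\<Union>(m, c) \<in> (SIGMA m:M_tuples p n. ?C m). {x \<in> GF_vectors p n. counts x = c})"
      using x by blast
  qed (auto simp: assemble_def count_type_eq)
  \<comment> \<open>A vector determines its counts and these determine their type, so the union is
    disjoint.\<close>
  have disj: "m = m' \<and> c = c'"
    if "m \<in> M_tuples p n" "c \<in> ?C m" "m' \<in> M_tuples p n" "c' \<in> ?C m'"
      "counts x = c" "counts x = c'" for m m' c c' x
    using that count_type_eq[of m c] count_type_eq[of m' c'] by auto
  have fin: "finite (?C m)" for m
    using finite_fibre_funs[OF finite_K, of "{0..n}" m] by simp
  have "card {x \<in> GF_vectors p n. assemble G x = k}
      = (\<Sum>(m, c) \<in> (SIGMA m:M_tuples p n. ?C m). card {x \<in> GF_vectors p n. counts x = c})"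
    unfolding eq using fin finite_M_tuples finite_vectors
    by (subst card_UN_disjoint) (use disj in \<open>auto simp: split_def intro!: sum.cong\<close>)
  also have "\<dots> = (\<Sum>m\<in>M_tuples p n. \<Sum>c\<in>?C m. card {x \<in> GF_vectors p n. counts x = c})"
    using fin finite_M_tuples by (subst sum.Sigma) auto
  also have "\<dots> = (\<Sum>m\<in>M_tuples p n. D m * type_weight m)"
  proof (rule sum.cong[OF refl])
    fix m assume m: "m \<in> M_tuples p n"
    have "card (?C m) = D m" using PiE_mem[OF G m] k by (auto simp: fibre_funs_def)
    then show "(\<Sum>c\<in>?C m. card {x \<in> GF_vectors p n. counts x = c}) = D m * type_weight m"
      using card_vectors_with_counts_eq[OF m] by simp
  qed
  finally show ?thesis .
qed

text \<open>The fibres have equal cardinality by the previous lemma; as they partition the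
  \<open>p ^ n\<close> vectors, that cardinality need not be evaluated.\<close>

lemma balanced_assemble:
  assumes G: "G \<in> even_assignments D"
  shows "balanced_function p n (assemble G)"
proof -
  let ?w = "\<Sum>m\<in>M_tuples p n. D m * type_weight m"
  have "assemble G ` GF_vectors p n \<subseteq> K"
    using assemble_mem_functions[OF G] by (auto simp: GF_functions_def K_def)
  then have "(\<Sum>k\<in>K. card {x \<in> GF_vectors p n. assemble G x = k}) = p ^ n"
    using sum.group[OF finite_vectors finite_K, of "assemble G" "\<lambda>_. 1::nat"] card_vectors by simp
  then have "p * ?w = p ^ n"
    using card_assemble_fibre[OF G] card_K by simp
  also have "\<dots> = p * p ^ (n - 1)" using n by (simp add: power_eq_if)
  finally have "?w = p ^ (n - 1)" using p by simp
  then show ?thesis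
    using card_assemble_fibre[OF G] by (simp add: balanced_function_def K_def)
qed

lemma card_even_assignments_le: "card (even_assignments D) \<le> num_balanced_symmetric p n"
  unfolding num_balanced_symmetric_def
proof (rule card_inj_on_le[OF inj_on_assemble])
  show "assemble ` even_assignments D
      \<subseteq> {f \<in> GF_functions p n. balanced_function p n f \<and> symmetric_function p n f}"
    using assemble_mem_functions balanced_assemble symmetric_assemble by blast
  show "finite {f \<in> GF_functions p n. balanced_function p n f \<and> symmetric_function p n f}"
    using finite_vectors finite_K by (simp add: GF_functions_def K_def finite_PiE)
qed

text \<open>The assumption says that \<open>p\<close> fibres of size \<open>D m\<close> exhaust the
  counts of type \<open>m\<close>, so the multinomial count applies. The choices for different types
  are independent, hence the product.\<close>

lemma card_even_assignments:
  assumes "\<And>m. m \<in> M_tuples p n \<Longrightarrow> p * D m = card (counts_of_type m)"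
  shows "real (card (even_assignments D))
    = (\<Prod>m\<in>M_tuples p n. fact (card (counts_of_type m)) / fact (D m) ^ p)"
proof -
  have "real (card (fibre_funs (counts_of_type m) K (\<lambda>_. D m)))
      = fact (card (counts_of_type m)) / fact (D m) ^ p" if "m \<in> M_tuples p n" for m
  proof -
    have "card (fibre_funs (counts_of_type m) K (\<lambda>_. D m)) * fact (D m) ^ p
        = fact (card (counts_of_type m))"
      using card_fibre_funs[OF finite_K, of "counts_of_type m" "\<lambda>_. D m"] assms[OF that]
        finite_fibre_funs[OF finite_K, of "{0..n}" m] card_K by simp
    then have "real (card (fibre_funs (counts_of_type m) K (\<lambda>_. D m))) * fact (D m) ^ p
        = fact (card (counts_of_type m))"
      by (metis of_nat_fact of_nat_mult of_nat_power)
    then show ?thesis by (simp add: field_simps)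
  qed
  then show ?thesis using finite_M_tuples by (simp add: card_PiE)
qed

end

theorem theorem1:
  fixes p n :: nat
  assumes "prime p" and "n \<ge> 1"
    and "(\<forall>m\<in>M_tuples p n. \<forall>i\<in>{0..n}. m i < p) \<or> gcd n p = 1"
  shows "real (num_balanced_symmetric p n) \<ge>
    (\<Prod>m\<in>M_tuples p n.
      fact (fact p div (\<Prod>j=0..n. fact (m j))) /
      (fact (fact (p - 1) div (\<Prod>j=0..n. fact (m j)))) ^ p)"
proof -
  have p: "p > 0" using assms(1) by (rule prime_gt_0_nat)
  define D :: "(nat \<Rightarrow> nat) \<Rightarrow> nat" where "D m = fact (p - 1) div (\<Prod>j=0..n. fact (m j))" for m
  \<comment> \<open>The hypothesis on \<open>p\<close> and \<open>n\<close> enters here: either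
    alternative makes the denominator divide \<open>fact (p - 1)\<close>, so \<open>D m\<close> is
    exactly one \<open>p\<close>-th of the number of counts of type \<open>m\<close>.\<close>
  have D: "p * D m = fact p div (\<Prod>j=0..n. fact (m j))" if "m \<in> M_tuples p n" for m
    using M_tuples_dvd_fact_pred[OF assms(1,3) that] p
    by (simp add: D_def fact_reduce div_mult_swap)
  note card_type = card_counts_of_type[OF refl p assms(2)]
  have "(\<Prod>m\<in>M_tuples p n. fact (fact p div (\<Prod>j=0..n. fact (m j))) / (fact (D m)) ^ p)
      = real (card (\<Pi>\<^sub>E m\<in>M_tuples p n.
          fibre_funs (fibre_funs (carrier (GF p)) {0..n} m) (carrier (GF p)) (\<lambda>_. D m)))"
    by (subst card_even_assignments[OF refl p assms(2)]) (auto simp: D card_type intro!: prod.cong)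
  also have "\<dots> \<le> real (num_balanced_symmetric p n)"
    using card_even_assignments_le[OF refl p assms(2)] by simp
  finally show ?thesis by (simp add: D_def)
qed

end
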